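(* For each $n$ let $H_n$ be an $(n,d_n,\lambda_n)$ weighted graph with all weights in $[0,1]$, and let $H'_n$ be the random graph corresponding to $H_n$. Suppose that $$d_n=\omega(n^{1/2}),\qquad \limsup_{n\to\infty}\frac{\lambda_n}{d_n}<1.$$ Then $$\left|q^*(H_n)-q^*(H'_n)\right|\to 0\quad\text{almost surely as } n\to\infty.$$
   Context: A weighted graph on a finite vertex set $V$ is given by a symmetric weight function $w:V\times V\to[0,\infty)$ with $w(v,v)=0$ for all $v$ (weights are put on the edges of the complete graph on $V$). The degree is $\deg(v)=\sum_{u\in V}w(v,u)$; the weighted graph is $d$-regular if $\deg(v)=d$ for all $v$. Its spectrum is the sequence $\lambda_1\ge\lambda_2\ge\dots\ge\lambda_n$ of eigenvalues of the symmetric matrix $W=(w(i,j))_{i,j}$, $n=|V|$. An $(n,d,\lambda)$ weighted graph is a $d$-regular weighted graph on $n\ge2$ vertices with $\lambda=\max\{|\lambda_2|,\dots,|\lambda_n|\}$ (then $\lambda_1=d$). If all weights lie in $[0,1]$, the corresponding random graph is the random simple graph on the same vertex set in which each edge $\{i,j\}$ is drawn with probability $w(i,j)$ independently of all others. The random graphs $H'_n$ are considered on a common probability space. Modularity: for a weighted graph $G$ and a set $A$ of vertices, $e(A)$ is the sum of $w(u,v)$ over unordered pairs $\{u,v\}\subseteq A$ of distinct vertices, and $e(G)=e(V)$. If $e(G)>0$, for a partition $\mathcal A$ of $V$, $$q(\mathcal A)=\sum_{A\in\mathcal A}\frac{e(A)}{e(G)}-\sum_{A\in\mathcal A}\frac{\left(\sum_{v\in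 A}\deg(v)\right)^2}{4e(G)^2},$$ and $q^*(G)=\max_{\mathcal A}q(\mathcal A)$ over all partitions of $V$. An ordinary graph is regarded as a weighted graph with weight $1$ on edges and $0$ on non-edges. The notation $a_n=\omega(b_n)$ means $a_n/b_n\to\infty$. *)

theory Defs
  imports "HOL-Probability.Probability" "Jordan_Normal_Form.Char_Poly"
begin

section \<open>Weighted graphs and their spectra\<close>

definition weighted_graph :: "'a set \<Rightarrow> ('a \<Rightarrow> 'a \<Rightarrow> real) \<Rightarrow> bool" where
  "weighted_graph V w \<longleftrightarrow> finite V \<and>
     (\<forall>u\<in>V. \<forall>v\<in>V. 0 \<le> w u v \<and> w u v = w v u) \<and> (\<forall>v\<in>V. w v v = 0)"

definition wdegree :: "'a set \<Rightarrow> ('a \<Rightarrow> 'a \<Rightarrow> real) \<Rightarrow> 'a \<Rightarrow> real" where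
  "wdegree V w v = (\<Sum>u\<in>V. w v u)"

definition wregular :: "'a set \<Rightarrow> ('a \<Rightarrow> 'a \<Rightarrow> real) \<Rightarrow> real \<Rightarrow> bool" where
  "wregular V w d \<longleftrightarrow> (\<forall>v\<in>V. wdegree V w v = d)"

definition weight_matrix :: "'a list \<Rightarrow> ('a \<Rightarrow> 'a \<Rightarrow> real) \<Rightarrow> real mat" where
  "weight_matrix vs w = mat (length vs) (length vs) (\<lambda>(i, j). w (vs ! i) (vs ! j))"

text \<open>The vertices are enumerated in order to write the weights as a matrix. The choice is
  immaterial: another enumeration conjugates the matrix by a permutation matrix. For a weighted
  graph the matrix is real symmetric, so the multiset of real roots of its characteristic
  polynomial consists of all \<open>card V\<close> eigenvalues, with multiplicity.\<close>

definition graph_spectrum :: "'a set \<Rightarrow> ('a \<Rightarrow> 'a \<Rightarrow> real) \<Rightarrow> real list" where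
  "graph_spectrum V w =
     (let vs = (SOME vs. distinct vs \<and> set vs = V)
      in rev (sorted_list_of_multiset (proots (char_poly (weight_matrix vs w)))))"

definition ndl_graph :: "nat \<Rightarrow> real \<Rightarrow> real \<Rightarrow> 'a set \<Rightarrow> ('a \<Rightarrow> 'a \<Rightarrow> real) \<Rightarrow> bool" where
  "ndl_graph n d l V w \<longleftrightarrow> weighted_graph V w \<and> card V = n \<and> n \<ge> 2 \<and> wregular V w d \<and>
     l = Max (abs ` set (tl (graph_spectrum V w)))"

section \<open>Modularity\<close>

text \<open>The sum runs over ordered pairs, so it counts every unordered pair twice.\<close>

definition edge_weight :: "('a \<Rightarrow> 'a \<Rightarrow> real) \<Rightarrow> 'a set \<Rightarrow> real" where
  "edge_weight w A = (\<Sum>(u, v) | u \<in> A \<and> v \<in> A \<and> u \<noteq> v. w u v) / 2"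

text \<open>If the total weight is \<open>0\<close>, division by zero gives every partition modularity \<open>0\<close>, which is
  the usual convention for graphs without edges.\<close>

definition partition_modularity ::
    "'a set \<Rightarrow> ('a \<Rightarrow> 'a \<Rightarrow> real) \<Rightarrow> 'a set set \<Rightarrow> real" where
  "partition_modularity V w P =
     (\<Sum>A\<in>P. edge_weight w A / edge_weight w V) -
     (\<Sum>A\<in>P. (\<Sum>v\<in>A. wdegree V w v)\<^sup>2 / (4 * (edge_weight w V)\<^sup>2))"

definition modularity :: "'a set \<Rightarrow> ('a \<Rightarrow> 'a \<Rightarrow> real) \<Rightarrow> real" where
  "modularity V w = Max (partition_modularity V w ` {P. partition_on V P})"

section \<open>Random graphs\<close>

definition vertex_pairs :: "'a set \<Rightarrow> 'a set set" where
  "vertex_pairs V = {e. e \<subseteq> V \<and> card e = 2}"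

text \<open>A simple graph on \<open>V\<close> is given by its edge set, a subset of \<open>vertex_pairs V\<close>.\<close>

definition unit_weights :: "'a set set \<Rightarrow> 'a \<Rightarrow> 'a \<Rightarrow> real" where
  "unit_weights E u v = (if {u, v} \<in> E then 1 else 0)"

text \<open>Independence of the edge events includes their measurability.\<close>

definition random_graph ::
    "'b measure \<Rightarrow> 'a set \<Rightarrow> ('a \<Rightarrow> 'a \<Rightarrow> real) \<Rightarrow> ('b \<Rightarrow> 'a set set) \<Rightarrow> bool" where
  "random_graph M V w E \<longleftrightarrow>
     (\<forall>x\<in>space M. E x \<subseteq> vertex_pairs V) \<and>
     prob_space.indep_events M (\<lambda>e. {x \<in> space M. e \<in> E x}) (vertex_pairs V) \<and>
     (\<forall>u\<in>V. \<forall>v\<in>V. u \<noteq> v \<longrightarrow> measure M {x \<in> space M. {u, v} \<in> E x} = w u v)"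

end

theory Submission
  imports Defs "HOL-Real_Asymp.Real_Asymp"
begin

text \<open>
  The modularity of a partition is determined by two kinds of data: the weight inside the parts,
  relative to the total weight, and the relative volumes of the parts. Suppose that passing from
  \<open>w\<close> to another weighting changes the weight inside the parts of \<open>P\<close> by at most \<open>\<epsilon>\<close> times the
  total weight, and every degree by at most the factor \<open>1 \<plusminus> \<epsilon>\<close>. The first change moves the edge
  term by at most \<open>2 * \<epsilon>\<close>. The relative volumes \<open>a A\<close> form a probability vector before and after
  the change, and each of them moves by at most \<open>\<epsilon> * (a A + a' A)\<close>, so the degree term moves by at
  most \<open>4 * \<epsilon>\<close> however many parts there are (\<open>partition_modularity_stable\<close>). If this holds for
  all partitions, the maxima also differ by at most \<open>6 * \<epsilon>\<close>.

  For the random graph both kinds of data are sums of independent indicators, over the pairs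
  inside the parts of \<open>P\<close> and over the pairs at a vertex. A Chernoff bound
  (\<open>indep_events_concentration\<close>) makes the first deviation fail with probability at most
  \<open>2 * exp (- \<epsilon>\<^sup>2 * n * d / 8)\<close> and the second with probability at most \<open>2 * exp (- \<epsilon>\<^sup>2 * d / 4)\<close>.
  There are at most \<open>n ^ n = exp (n * ln n)\<close> partitions and \<open>n\<close> vertices. A degree that grows
  faster than \<open>\<surd>n\<close> outgrows every multiple of \<open>ln n\<close>, so the union bound gives a failure
  probability of at most \<open>4 / n\<^sup>2\<close> for large \<open>n\<close>, and the Borel--Cantelli lemma applies. The bound
  on the exponential moment matters here: Hoeffding's inequality with its \<open>n\<^sup>2 / 2\<close> summands would
  give only \<open>exp (- \<epsilon>\<^sup>2 * d\<^sup>2)\<close>, which need not beat \<open>n ^ n\<close>.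
\<close>

section \<open>Edge weights, degrees and partitions\<close>

lemma sum_over_partition:
  fixes f :: "'a \<Rightarrow> real"
  assumes "finite V" "partition_on V P"
  shows "(\<Sum>A\<in>P. \<Sum>v\<in>A. f v) = (\<Sum>v\<in>V. f v)"
proof -
  have "(\<Sum>v\<in>\<Union>P. f v) = (\<Sum>A\<in>P. \<Sum>v\<in>A. f v)"
    using assms by (subst sum.Union_disjoint)
      (auto simp: partition_on_def pairwise_def disjnt_def intro: finite_subset)
  then show ?thesis
    using assms by (simp add: partition_on_def)
qed

lemma edge_weight_double_sum:
  assumes "weighted_graph V w" "A \<subseteq> V"
  shows "2 * edge_weight w A = (\<Sum>u\<in>A. \<Sum>v\<in>A. w u v)"
proof -
  have fin: "finite A"
    using assms by (auto simp: weighted_graph_def intro: finite_subset)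
  have "(\<Sum>u\<in>A. \<Sum>v\<in>A. w u v) = (\<Sum>(u, v)\<in>A \<times> A. w u v)"
    by (simp add: sum.cartesian_product)
  also have "\<dots> = (\<Sum>(u, v) | u \<in> A \<and> v \<in> A \<and> u \<noteq> v. w u v)"
    using assms fin by (intro sum.mono_neutral_right) (auto simp: weighted_graph_def)
  finally show ?thesis
    by (simp add: edge_weight_def)
qed

lemma handshake:
  assumes "weighted_graph V w"
  shows "(\<Sum>v\<in>V. wdegree V w v) = 2 * edge_weight w V"
  using edge_weight_double_sum[OF assms order_refl] by (simp add: wdegree_def)

lemma wdegree_nonneg: "weighted_graph V w \<Longrightarrow> v \<in> V \<Longrightarrow> 0 \<le> wdegree V w v"
  by (auto simp: wdegree_def weighted_graph_def intro: sum_nonneg)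

text \<open>Each edge inside \<open>A\<close> is counted at both of its ends, while edges that leave \<open>A\<close> only add to
  the volume.\<close>

lemma twice_edge_weight_le_volume:
  assumes "weighted_graph V w" "A \<subseteq> V"
  shows "2 * edge_weight w A \<le> (\<Sum>v\<in>A. wdegree V w v)"
  unfolding edge_weight_double_sum[OF assms] wdegree_def
  using assms by (intro sum_mono sum_mono2) (auto simp: weighted_graph_def)

lemma edge_weight_nonneg:
  assumes "weighted_graph V w" "A \<subseteq> V"
  shows "0 \<le> edge_weight w A"
proof -
  have "0 \<le> 2 * edge_weight w A"
    unfolding edge_weight_double_sum[OF assms]
    using assms by (intro sum_nonneg) (auto simp: weighted_graph_def)
  then show ?thesis by simp
qed

lemma inner_weight_le:
  assumes "weighted_graph V w" "partition_on V P"
  shows "(\<Sum>A\<in>P. edge_weight w A) \<le> edge_weight w V"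
proof -
  have fin: "finite V"
    using assms by (simp add: weighted_graph_def)
  have "2 * (\<Sum>A\<in>P. edge_weight w A) \<le> (\<Sum>A\<in>P. \<Sum>v\<in>A. wdegree V w v)"
    unfolding sum_distrib_left
    using assms by (intro sum_mono twice_edge_weight_le_volume) (auto simp: partition_on_def)
  also have "\<dots> = 2 * edge_weight w V"
    by (simp add: sum_over_partition[OF fin assms(2)] handshake[OF assms(1)])
  finally show ?thesis by simp
qed

section \<open>Stability of modularity under small relative changes\<close>

text \<open>The error of the numerator counts relative to \<open>y\<close>, not to \<open>x\<close>: a small numerator may be
  perturbed on the scale of the denominator, as happens for the weight inside the parts.\<close>

lemma quotient_diff_le:
  fixes x x' m m' y \<epsilon> :: real
  assumes "m > 0" "m' > 0" "0 \<le> x'" "\<bar>m' - m\<bar> \<le> \<epsilon> * m" "\<bar>x' - x\<bar> \<le> \<epsilon> * y"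
  shows "\<bar>x' / m' - x / m\<bar> \<le> \<epsilon> * (y / m) + \<epsilon> * (x' / m')"
proof -
  have eq: "x' / m' - x / m = (x' - x) / m + (x' / m') * ((m - m') / m)"
    using assms by (simp add: field_simps)
  have "\<bar>(x' - x) / m\<bar> \<le> \<epsilon> * (y / m)"
    using assms by (simp add: divide_right_mono)
  moreover have "\<bar>(m - m') / m\<bar> \<le> \<epsilon>"
    using assms by (simp add: pos_divide_le_eq abs_minus_commute)
  then have "\<bar>(x' / m') * ((m - m') / m)\<bar> \<le> (x' / m') * \<epsilon>"
    unfolding abs_mult using assms by (intro mult_mono) auto
  ultimately show ?thesis
    unfolding eq by (subst mult.commute[of \<epsilon> "x' / m'"]) linarith
qed

text \<open>The squared relative volumes are compared through
  \<open>(a' A)\<^sup>2 - (a A)\<^sup>2 = (a' A - a A) * (a' A + a A)\<close>. The first factor is bounded by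
  \<open>\<epsilon> * (a A + a' A)\<close>, which sums to \<open>2 * \<epsilon>\<close> over all parts, and the second by \<open>2\<close>; this is what
  makes the estimate independent of the number of parts.\<close>

lemma partition_modularity_stable:
  fixes \<epsilon> :: real
  assumes G: "weighted_graph V w" and G': "weighted_graph V w'"
    and P: "partition_on V P" and pos: "edge_weight w V > 0" and \<epsilon>: "0 \<le> \<epsilon>" "\<epsilon> < 1"
    and inner: "\<bar>(\<Sum>A\<in>P. edge_weight w' A) - (\<Sum>A\<in>P. edge_weight w A)\<bar> \<le> \<epsilon> * edge_weight w V"
    and deg: "\<And>v. v \<in> V \<Longrightarrow> \<bar>wdegree V w' v - wdegree V w v\<bar> \<le> \<epsilon> * wdegree V w v"
  shows "\<bar>partition_modularity V w P - partition_modularity V w' P\<bar> \<le> 6 * \<epsilon>"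
proof -
  define m m' where "m = edge_weight w V" and "m' = edge_weight w' V"
  define a where "a A = (\<Sum>v\<in>A. wdegree V w v) / (2 * m)" for A
  define a' where "a' A = (\<Sum>v\<in>A. wdegree V w' v) / (2 * m')" for A
  have fin: "finite V"
    using G by (simp add: weighted_graph_def)
  have finP: "finite P"
    using finite_elements[OF fin P] .
  have sub: "A \<subseteq> V" if "A \<in> P" for A
    using P that by (auto simp: partition_on_def)
  have volume: "\<bar>(\<Sum>v\<in>A. wdegree V w' v) - (\<Sum>v\<in>A. wdegree V w v)\<bar> \<le> \<epsilon> * (\<Sum>v\<in>A. wdegree V w v)"
    if "A \<subseteq> V" for A
    unfolding sum_subtractf[symmetric] sum_distrib_left
    using that deg by (intro order_trans[OF sum_abs] sum_mono) auto
  have "\<bar>2 * m' - 2 * m\<bar> \<le> \<epsilon> * (2 * m)"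
    using volume[OF order_refl] by (simp add: handshake G G' m_def m'_def)
  then have m_diff: "\<bar>m' - m\<bar> \<le> \<epsilon> * m" by linarith
  have m: "m > 0"
    using pos by (simp add: m_def)
  have "\<epsilon> * m < m"
    using \<epsilon> m by simp
  with m_diff have m': "m' > 0" by linarith

  let ?S = "\<Sum>A\<in>P. edge_weight w A" and ?S' = "\<Sum>A\<in>P. edge_weight w' A"
  have S': "0 \<le> ?S'"
    using edge_weight_nonneg[OF G'] sub by (intro sum_nonneg) auto
  have "\<bar>?S' / m' - ?S / m\<bar> \<le> \<epsilon> * (m / m) + \<epsilon> * (?S' / m')"
    using quotient_diff_le[OF m m' S' m_diff inner[folded m_def]] .
  also have "\<dots> \<le> \<epsilon> * 1 + \<epsilon> * 1"
    using m m' \<epsilon> inner_weight_le[OF G' P]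
    by (intro add_mono mult_left_mono) (auto simp: m'_def)
  finally have edges: "\<bar>?S' / m' - ?S / m\<bar> \<le> 2 * \<epsilon>" by simp

  have a_nonneg: "0 \<le> a A" and a'_nonneg: "0 \<le> a' A" if "A \<in> P" for A
    using sub[OF that] wdegree_nonneg[OF G] wdegree_nonneg[OF G'] m m'
    by (auto simp: a_def a'_def intro!: divide_nonneg_pos sum_nonneg)
  have sum_a: "sum a P = 1" and sum_a': "sum a' P = 1"
    using m m' by (simp_all add: a_def[abs_def] a'_def[abs_def] flip: sum_divide_distrib,
      simp_all add: sum_over_partition[OF fin P] handshake G G' m_def m'_def)
  have a_le: "a A \<le> 1" and a'_le: "a' A \<le> 1" if "A \<in> P" for A
    using member_le_sum[of A P a] member_le_sum[of A P a'] that a_nonneg a'_nonneg finP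
    by (auto simp: sum_a sum_a')
  have square_diff: "\<bar>(a' A)\<^sup>2 - (a A)\<^sup>2\<bar> \<le> 2 * (\<epsilon> * a A + \<epsilon> * a' A)" if A: "A \<in> P" for A
  proof -
    have "\<bar>a' A - a A\<bar> \<le> \<epsilon> * a A + \<epsilon> * a' A"
      unfolding a_def a'_def
    proof (rule quotient_diff_le)
      show "0 \<le> (\<Sum>v\<in>A. wdegree V w' v)"
        using sub[OF A] wdegree_nonneg[OF G'] by (auto intro: sum_nonneg)
    qed (use m m' m_diff volume[OF sub[OF A]] in auto)
    moreover have "\<bar>a' A + a A\<bar> \<le> 2"
      using a_le[OF A] a'_le[OF A] a_nonneg[OF A] a'_nonneg[OF A] by simp
    ultimately have "\<bar>a' A - a A\<bar> * \<bar>a' A + a A\<bar> \<le> (\<epsilon> * a A + \<epsilon> * a' A) * 2"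
      using \<epsilon> a_nonneg[OF A] a'_nonneg[OF A] by (intro mult_mono) auto
    then show ?thesis
      by (simp add: abs_mult[symmetric] power2_eq_square algebra_simps)
  qed
  have "\<bar>(\<Sum>A\<in>P. (a' A)\<^sup>2) - (\<Sum>A\<in>P. (a A)\<^sup>2)\<bar> \<le> (\<Sum>A\<in>P. 2 * (\<epsilon> * a A + \<epsilon> * a' A))"
    unfolding sum_subtractf[symmetric]
    by (intro order_trans[OF sum_abs] sum_mono square_diff)
  also have "\<dots> = 2 * (\<epsilon> * sum a P + \<epsilon> * sum a' P)"
    by (simp flip: sum_distrib_left add: sum.distrib)
  finally have degrees: "\<bar>(\<Sum>A\<in>P. (a' A)\<^sup>2) - (\<Sum>A\<in>P. (a A)\<^sup>2)\<bar> \<le> 4 * \<epsilon>"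
    by (simp add: sum_a sum_a')

  have "partition_modularity V w P = ?S / m - (\<Sum>A\<in>P. (a A)\<^sup>2)"
    by (simp add: partition_modularity_def m_def[symmetric] a_def power_divide
        power_mult_distrib sum_divide_distrib[of "edge_weight w" P m])
  moreover have "partition_modularity V w' P = ?S' / m' - (\<Sum>A\<in>P. (a' A)\<^sup>2)"
    by (simp add: partition_modularity_def m'_def[symmetric] a'_def power_divide
        power_mult_distrib sum_divide_distrib[of "edge_weight w'" P m'])
  ultimately show ?thesis
    using edges degrees by linarith
qed

text \<open>A bound that is uniform in the partition passes to the maxima, since the maximizing partition
  of either side is a competitor on the other.\<close>

lemma modularity_stable:
  fixes \<epsilon> :: real
  assumes "finite V"
    and close: "\<And>P. partition_on V P \<Longrightarrow>
      \<bar>partition_modularity V w P - partition_modularity V w' P\<bar> \<le> \<epsilon>"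
  shows "\<bar>modularity V w - modularity V w'\<bar> \<le> \<epsilon>"
proof -
  let ?Q = "{P. partition_on V P}"
  have fin: "finite ?Q"
    using finitely_many_partition_on[OF assms(1)] .
  have ne: "?Q \<noteq> {}"
    using partition_on_singletons[of V] by blast
  have le: "modularity V f \<le> modularity V g + \<epsilon>"
    if *: "\<And>P. partition_on V P \<Longrightarrow> partition_modularity V f P \<le> partition_modularity V g P + \<epsilon>"
    for f g
  proof -
    have "modularity V f \<in> partition_modularity V f ` ?Q"
      unfolding modularity_def using fin ne by (intro Max_in) auto
    then obtain P where P: "partition_on V P" "modularity V f = partition_modularity V f P"
      by auto
    moreover have "partition_modularity V g P \<le> modularity V g"
      unfolding modularity_def using fin P(1) by (intro Max_ge) auto
    ultimately show ?thesis
      using *[OF P(1)] by linarith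
  qed
  have "modularity V w \<le> modularity V w' + \<epsilon>"
    by (rule le) (use close in \<open>force simp: abs_le_iff\<close>)
  moreover have "modularity V w' \<le> modularity V w + \<epsilon>"
    by (rule le) (use close in \<open>force simp: abs_le_iff\<close>)
  ultimately show ?thesis by linarith
qed

section \<open>Weights as sums over vertex pairs\<close>

lemma vertex_pair_cases:
  assumes "e \<in> vertex_pairs A"
  obtains a b where "e = {a, b}" "a \<in> A" "b \<in> A" "a \<noteq> b"
  using assms by (auto simp: vertex_pairs_def card_2_iff)

lemma finite_vertex_pairs: "finite A \<Longrightarrow> finite (vertex_pairs A)"
  by (rule finite_subset[of _ "Pow A"]) (auto simp: vertex_pairs_def)

text \<open>The probability space supplies one event for each unordered pair, so the weights, which are
  sums over ordered pairs, have to be rewritten as sums over distinct independent events.\<close>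

lemma edge_weight_eq_sum_pairs:
  assumes "finite A" and p: "\<And>u v. u \<in> A \<Longrightarrow> v \<in> A \<Longrightarrow> u \<noteq> v \<Longrightarrow> w u v = p {u, v}"
  shows "edge_weight w A = (\<Sum>e\<in>vertex_pairs A. p e)"
proof -
  define S where "S = {(u, v). u \<in> A \<and> v \<in> A \<and> u \<noteq> v}"
  have finS: "finite S"
    using assms(1) by (intro finite_subset[of S "A \<times> A"]) (auto simp: S_def)
  have "sum (case_prod w) S =
      (\<Sum>e\<in>vertex_pairs A. sum (case_prod w) {z \<in> S. (case z of (u, v) \<Rightarrow> {u, v}) = e})"
    using assms(1) finS
    by (intro sum.group[symmetric] finite_vertex_pairs) (auto simp: S_def vertex_pairs_def)
  also have "\<dots> = (\<Sum>e\<in>vertex_pairs A. 2 * p e)"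
  proof (rule sum.cong)
    fix e assume "e \<in> vertex_pairs A"
    then obtain a b where e: "e = {a, b}" "a \<in> A" "b \<in> A" "a \<noteq> b"
      by (rule vertex_pair_cases)
    have "{z \<in> S. (case z of (u, v) \<Rightarrow> {u, v}) = e} = {(a, b), (b, a)}"
      using e by (auto simp: S_def doubleton_eq_iff)
    moreover have "p {b, a} = p {a, b}"
      by (simp add: insert_commute)
    ultimately show "sum (case_prod w) {z \<in> S. (case z of (u, v) \<Rightarrow> {u, v}) = e} = 2 * p e"
      using e p[of a b] p[of b a] by simp
  qed simp
  finally show ?thesis
    by (simp add: edge_weight_def S_def sum_distrib_left[symmetric])
qed

definition inner_pairs :: "'a set set \<Rightarrow> 'a set set" where
  "inner_pairs P = (\<Union>A\<in>P. vertex_pairs A)"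

definition star :: "'a set \<Rightarrow> 'a \<Rightarrow> 'a set set" where
  "star V v = (\<lambda>u. {v, u}) ` (V - {v})"

lemma inner_pairs_subset: "partition_on V P \<Longrightarrow> inner_pairs P \<subseteq> vertex_pairs V"
  by (auto simp: inner_pairs_def vertex_pairs_def partition_on_def)

lemma star_subset: "v \<in> V \<Longrightarrow> star V v \<subseteq> vertex_pairs V"
  by (auto simp: star_def vertex_pairs_def)

lemma inner_weight_eq_sum_pairs:
  assumes fin: "finite V" and P: "partition_on V P"
    and p: "\<And>u v. u \<in> V \<Longrightarrow> v \<in> V \<Longrightarrow> u \<noteq> v \<Longrightarrow> w u v = p {u, v}"
  shows "(\<Sum>A\<in>P. edge_weight w A) = (\<Sum>e\<in>inner_pairs P. p e)"
proof -
  have sub: "A \<subseteq> V" if "A \<in> P" for A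
    using P that by (auto simp: partition_on_def)
  have finA: "finite A" if "A \<in> P" for A
    using sub[OF that] fin by (rule finite_subset)
  have disj: "vertex_pairs A \<inter> vertex_pairs B = {}" if "A \<in> P" "B \<in> P" "A \<noteq> B" for A B
  proof -
    have "A \<inter> B = {}"
      using P that by (auto simp: partition_on_def disjoint_def)
    then have "e = {}" if "e \<subseteq> A" "e \<subseteq> B" for e
      using that by blast
    then have "\<not> (e \<subseteq> A \<and> e \<subseteq> B \<and> card e = 2)" for e
      by (metis card.empty zero_neq_numeral)
    then show ?thesis
      unfolding vertex_pairs_def by blast
  qed
  have "(\<Sum>A\<in>P. edge_weight w A) = (\<Sum>A\<in>P. \<Sum>e\<in>vertex_pairs A. p e)"
  proof (intro sum.cong refl edge_weight_eq_sum_pairs finA)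
    fix A u v assume "A \<in> P" "u \<in> A" "v \<in> A" "u \<noteq> v"
    then show "w u v = p {u, v}"
      using sub[of A] by (intro p) auto
  qed
  also have "\<dots> = (\<Sum>e\<in>inner_pairs P. p e)"
    unfolding inner_pairs_def
    using finite_elements[OF fin P] finA disj
    by (intro sum.UNION_disjoint[symmetric]) (auto intro: finite_vertex_pairs)
  finally show ?thesis .
qed

lemma wdegree_eq_sum_star:
  assumes "finite V" "v \<in> V" "w v v = 0"
    and "\<And>u. u \<in> V \<Longrightarrow> u \<noteq> v \<Longrightarrow> w v u = p {v, u}"
  shows "wdegree V w v = (\<Sum>e\<in>star V v. p e)"
proof -
  have "inj_on (\<lambda>u. {v, u}) (V - {v})"
    by (auto simp: inj_on_def doubleton_eq_iff)
  then have "(\<Sum>e\<in>star V v. p e) = (\<Sum>u\<in>V - {v}. p {v, u})"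
    by (simp add: star_def sum.reindex)
  also have "\<dots> = (\<Sum>u\<in>V - {v}. w v u)"
    using assms by (intro sum.cong) auto
  also have "\<dots> = wdegree V w v"
    using assms by (simp add: wdegree_def sum.remove[of V v])
  finally show ?thesis by simp
qed

text \<open>A partition is recovered from the map that sends each vertex to a chosen representative of
  its part, as the family of the nonempty fibres of this map.\<close>

lemma card_partitions_le:
  assumes "finite V"
  shows "card {P. partition_on V P} \<le> card V ^ card V"
proof -
  define fibres where "fibres f = (\<lambda>y. {v \<in> V. f v = y}) ` (f ` V)" for f :: "'a \<Rightarrow> 'a"
  have "{P. partition_on V P} \<subseteq> fibres ` (V \<rightarrow>\<^sub>E V)"
  proof
    fix P assume "P \<in> {P. partition_on V P}"
    then have P: "partition_on V P" by simp
    then have "\<exists>A. A \<in> P \<and> v \<in> A" if "v \<in> V" for v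
      using that by (auto simp: partition_on_def)
    then obtain b where b: "\<And>v. v \<in> V \<Longrightarrow> b v \<in> P \<and> v \<in> b v" by metis
    have sub: "A \<subseteq> V" if "A \<in> P" for A
      using P that by (auto simp: partition_on_def)
    have uniq: "b v = A" if "A \<in> P" "v \<in> A" for v A
      using P that b[of v] sub[OF that(1)] by (auto simp: partition_on_def disjoint_def)
    define r where "r A = (SOME v. v \<in> A)" for A :: "'a set"
    have r: "r A \<in> A" if "A \<in> P" for A
      using P that unfolding r_def by (metis partition_onD3 some_in_eq)
    define f where "f = (\<lambda>v\<in>V. r (b v))"
    have block: "{v \<in> V. f v = r A} = A" if A: "A \<in> P" for A
    proof -
      have "b v = A" if "v \<in> V" "r (b v) = r A" for v
        using uniq[OF A r[OF A]] uniq[of "b v" "r (b v)"] r b that by metis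
      then have "v \<in> A" if "v \<in> V" "f v = r A" for v
        using that b[of v] by (auto simp: f_def)
      moreover have "v \<in> V \<and> f v = r A" if "v \<in> A" for v
        using that sub[OF A] uniq[OF A] by (auto simp: f_def)
      ultimately show ?thesis by blast
    qed
    have img: "f ` V = r ` P"
    proof
      show "f ` V \<subseteq> r ` P"
        using b by (auto simp: f_def)
      show "r ` P \<subseteq> f ` V"
      proof
        fix y assume "y \<in> r ` P"
        then obtain A where A: "A \<in> P" "y = r A" by auto
        then have "r A \<in> V" "f (r A) = r A"
          using r[of A] sub[of A] uniq[of A "r A"] by (auto simp: f_def)
        then show "y \<in> f ` V"
          using A by (metis imageI)
      qed
    qed
    have "fibres f = (\<lambda>A. {v \<in> V. f v = r A}) ` P"
      by (simp add: fibres_def img image_image)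
    also have "\<dots> = P"
      using block by simp
    finally have "P = fibres f" ..
    moreover have "f \<in> V \<rightarrow>\<^sub>E V"
      using b r sub by (fastforce simp: f_def)
    ultimately show "P \<in> fibres ` (V \<rightarrow>\<^sub>E V)" by (rule image_eqI)
  qed
  then have "card {P. partition_on V P} \<le> card (V \<rightarrow>\<^sub>E V)"
    using assms by (intro surj_card_le finite_PiE) auto
  also have "\<dots> = card V ^ card V"
    using assms by (simp add: card_funcsetE)
  finally show ?thesis .
qed

section \<open>A Chernoff bound for independent events\<close>

lemma exp_le_quadratic:
  fixes s :: real
  assumes "\<bar>s\<bar> \<le> 1"
  shows "exp s \<le> 1 + s + s\<^sup>2"
proof (cases "s \<ge> 0")
  case True
  then show ?thesis
    using assms by (intro exp_bound) auto
next
  case False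
  (* Pass to the reciprocal: exp y is at least 1 + y, and (1 - y + y^2) (1 + y) = 1 + y^3. *)
  define y where "y = - s"
  have y: "0 < y" "y \<le> 1"
    using False assms by (auto simp: y_def)
  have "1 \<le> (1 - y + y\<^sup>2) * (1 + y)"
    using y by (simp add: power2_eq_square algebra_simps)
  also have "\<dots> \<le> (1 - y + y\<^sup>2) * exp y"
    using y exp_ge_add_one_self[of y] by (intro mult_left_mono) auto
  finally have "exp (- y) \<le> 1 - y + y\<^sup>2"
    by (simp add: exp_minus field_simps)
  then show ?thesis
    by (simp add: y_def)
qed

context prob_space
begin

lemma expectation_prod_indicator_indep_events:
  assumes "indep_events S F" "T \<subseteq> F" "finite T"
  shows "(\<integral>x. (\<Prod>e\<in>T. indicator (S e) x) \<partial>M) = (\<Prod>e\<in>T. prob (S e))"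
proof (cases "T = {}")
  case True
  then show ?thesis by (simp add: prob_space)
next
  case False
  have S: "S e \<in> events" if "e \<in> F" for e
    using assms that by (auto simp: indep_events_def)
  have "(\<lambda>x. \<Prod>e\<in>T. indicator (S e) x) = (indicator (\<Inter>e\<in>T. S e) :: 'a \<Rightarrow> real)"
    using assms(3) by (auto simp: fun_eq_iff indicator_def)
  moreover have "(\<Inter>e\<in>T. S e) \<in> events"
    using S assms False by (intro sets.finite_INT) auto
  ultimately have "(\<integral>x. (\<Prod>e\<in>T. indicator (S e) x) \<partial>M) = prob (\<Inter>e\<in>T. S e)"
    by simp
  then show ?thesis
    using assms False by (simp add: indep_events_def)
qed

text \<open>Expanding the product into a sum over subsets reduces the claim to the defining property of
  independent events, that the probability of every finite intersection factorizes.\<close>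

lemma expectation_prod_indep_events:
  fixes c :: real and F :: "'i set"
  assumes fin: "finite F" and ind: "indep_events S F"
  shows "expectation (\<lambda>x. \<Prod>e\<in>F. 1 + c * indicator (S e) x) = (\<Prod>e\<in>F. 1 + c * prob (S e))"
proof -
  have meas: "S e \<in> events" if "e \<in> F" for e
    using ind that by (auto simp: indep_events_def)
  have expand: "(\<Prod>e\<in>F. 1 + c * f e) = (\<Sum>T\<in>Pow F. c ^ card T * (\<Prod>e\<in>T. f e))"
    for f :: "'i \<Rightarrow> real"
    using prod_add[OF fin, of "\<lambda>e. c * f e" "\<lambda>e. 1"] by (simp add: add.commute prod.distrib)
  have int: "integrable M (\<lambda>x. \<Prod>e\<in>T. indicator (S e) x :: real)" if "T \<subseteq> F" for T
  proof (rule integrable_const_bound[where B = 1])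
    show "(\<lambda>x. \<Prod>e\<in>T. indicator (S e) x :: real) \<in> borel_measurable M"
      using meas that by (intro borel_measurable_prod borel_measurable_indicator) auto
    show "AE x in M. norm (\<Prod>e\<in>T. indicator (S e) x :: real) \<le> 1"
      by (auto simp: abs_prod intro!: prod_le_1)
  qed
  have "expectation (\<lambda>x. \<Prod>e\<in>F. 1 + c * indicator (S e) x) =
      (\<Sum>T\<in>Pow F. c ^ card T * (\<integral>x. (\<Prod>e\<in>T. indicator (S e) x) \<partial>M))"
    unfolding expand using int by (subst Bochner_Integration.integral_sum) auto
  also have "\<dots> = (\<Sum>T\<in>Pow F. c ^ card T * (\<Prod>e\<in>T. prob (S e)))"
    using fin ind by (intro sum.cong refl arg_cong2[where f = "(*)"] expectation_prod_indicator_indep_events)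
      (auto intro: finite_subset)
  finally show ?thesis by (simp add: expand)
qed

text \<open>On an indicator, \<open>exp (s * \<cdot>)\<close> agrees with the affine function \<open>1 + (exp s - 1) * \<cdot>\<close>, so the
  exponential moment is a product. A factor with success probability \<open>p\<close> is at most
  \<open>1 + (s + s\<^sup>2) * p \<le> exp ((s + s\<^sup>2) * p)\<close>, and centring cancels the linear term. The bound
  is governed by the mean of the sum and not by the number of events.\<close>

lemma exp_moment_bound:
  fixes s :: real
  assumes fin: "finite F" and ind: "indep_events S F" and s: "\<bar>s\<bar> \<le> 1"
  defines "X \<equiv> \<lambda>x. (\<Sum>e\<in>F. indicator (S e) x) - (\<Sum>e\<in>F. prob (S e))"
  shows "integrable M (\<lambda>x. exp (s * X x))"
    and "expectation (\<lambda>x. exp (s * X x)) \<le> exp (s\<^sup>2 * (\<Sum>e\<in>F. prob (S e)))"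
proof -
  define \<mu> where "\<mu> = (\<Sum>e\<in>F. prob (S e))"
  have meas: "S e \<in> events" if "e \<in> F" for e
    using ind that by (auto simp: indep_events_def)
  have X: "X \<in> borel_measurable M"
    unfolding X_def using meas
    by (intro borel_measurable_diff borel_measurable_sum borel_measurable_indicator) auto
  have "\<bar>X x\<bar> \<le> real (card F) + \<mu>" for x
  proof -
    have "(\<Sum>e\<in>F. indicator (S e) x :: real) \<le> (\<Sum>e\<in>F. 1)"
      by (intro sum_mono) (auto simp: indicator_def)
    moreover have "0 \<le> (\<Sum>e\<in>F. indicator (S e) x :: real)" "0 \<le> \<mu>"
      by (auto simp: \<mu>_def intro: sum_nonneg)
    ultimately show ?thesis
      by (simp add: X_def \<mu>_def abs_le_iff)
  qed
  then have "\<bar>s\<bar> * \<bar>X x\<bar> \<le> 1 * (real (card F) + \<mu>)" for x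
    using s by (intro mult_mono) auto
  then have "s * X x \<le> real (card F) + \<mu>" for x
    by (metis abs_ge_self abs_mult mult_1 order_trans)
  then show "integrable M (\<lambda>x. exp (s * X x))"
    using X by (intro integrable_const_bound[where B = "exp (real (card F) + \<mu>)"]) auto
  have "exp (s * X x) = exp (- s * \<mu>) * (\<Prod>e\<in>F. 1 + (exp s - 1) * indicator (S e) x)" for x
  proof -
    have "exp (s * indicator (S e) x) = 1 + (exp s - 1) * indicator (S e) x" for e
      by (auto simp: indicator_def)
    then have "exp (s * (\<Sum>e\<in>F. indicator (S e) x)) = (\<Prod>e\<in>F. 1 + (exp s - 1) * indicator (S e) x)"
      by (simp add: sum_distrib_left exp_sum[OF fin])
    then show ?thesis
      by (simp add: X_def \<mu>_def right_diff_distrib exp_diff exp_minus field_simps)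
  qed
  then have "expectation (\<lambda>x. exp (s * X x)) =
      exp (- s * \<mu>) * (\<Prod>e\<in>F. 1 + (exp s - 1) * prob (S e))"
    by (simp add: expectation_prod_indep_events[OF fin ind])
  also have "\<dots> \<le> exp (- s * \<mu>) * (\<Prod>e\<in>F. exp ((s + s\<^sup>2) * prob (S e)))"
  proof (intro mult_left_mono prod_mono conjI)
    fix e
    have "0 \<le> (1 - prob (S e)) + exp s * prob (S e)"
      by (intro add_nonneg_nonneg) auto
    then show "0 \<le> 1 + (exp s - 1) * prob (S e)"
      by (simp add: algebra_simps)
    have "(exp s - 1) * prob (S e) \<le> (s + s\<^sup>2) * prob (S e)"
      using exp_le_quadratic[OF s] by (intro mult_right_mono) auto
    also have "1 + (s + s\<^sup>2) * prob (S e) \<le> exp ((s + s\<^sup>2) * prob (S e))"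
      by (rule exp_ge_add_one_self)
    finally show "1 + (exp s - 1) * prob (S e) \<le> exp ((s + s\<^sup>2) * prob (S e))"
      by simp
  qed simp
  also have "\<dots> = exp (s\<^sup>2 * \<mu>)"
    by (simp add: exp_sum[OF fin, symmetric] flip: sum_distrib_left \<mu>_def exp_add)
      (simp add: algebra_simps)
  finally show "expectation (\<lambda>x. exp (s * X x)) \<le> exp (s\<^sup>2 * (\<Sum>e\<in>F. prob (S e)))"
    by (simp add: \<mu>_def)
qed

text \<open>Markov's inequality for the exponential moments of both signs. The bound \<open>K\<close> may exceed
  the mean: the weight inside the parts of a partition is measured on the scale of the total
  weight, however small it is itself.\<close>

lemma indep_events_concentration:
  fixes \<epsilon> K :: real
  assumes fin: "finite F" and ind: "indep_events S F"
    and \<epsilon>: "0 \<le> \<epsilon>" "\<epsilon> \<le> 1" and K: "(\<Sum>e\<in>F. prob (S e)) \<le> K"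
  shows "prob {x \<in> space M. \<bar>(\<Sum>e\<in>F. indicator (S e) x) - (\<Sum>e\<in>F. prob (S e))\<bar> \<ge> \<epsilon> * K}
    \<le> 2 * exp (- \<epsilon>\<^sup>2 * K / 4)"
proof -
  define X where "X x = (\<Sum>e\<in>F. indicator (S e) x) - (\<Sum>e\<in>F. prob (S e))" for x
  have meas: "S e \<in> events" if "e \<in> F" for e
    using ind that by (auto simp: indep_events_def)
  have [measurable]: "X \<in> borel_measurable M"
    unfolding X_def[abs_def] using meas
    by (intro borel_measurable_diff borel_measurable_sum borel_measurable_indicator) auto
  have tail: "prob {x \<in> space M. \<sigma> * X x \<ge> \<epsilon> * K} \<le> exp (- \<epsilon>\<^sup>2 * K / 4)" if \<sigma>: "\<bar>\<sigma>\<bar> = 1" for \<sigma>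
  proof -
    (* The size eps / 2 minimizes the exponent s^2 K - s eps K. *)
    define s where "s = \<sigma> * (\<epsilon> / 2)"
    have s: "\<bar>s\<bar> \<le> 1" and s2: "s\<^sup>2 = \<epsilon>\<^sup>2 / 4"
      using \<epsilon> \<sigma> power2_abs[of \<sigma>]
      by (simp_all add: s_def abs_mult power_mult_distrib power_divide)
    note mom = exp_moment_bound[OF fin ind s, folded X_def]
    have "prob {x \<in> space M. \<sigma> * X x \<ge> \<epsilon> * K} \<le> prob {x \<in> space M. exp (\<epsilon>\<^sup>2 * K / 2) \<le> exp (s * X x)}"
    proof (intro finite_measure_mono subsetI)
      fix x assume "x \<in> {x \<in> space M. \<sigma> * X x \<ge> \<epsilon> * K}"
      then have "x \<in> space M" "(\<epsilon> / 2) * (\<epsilon> * K) \<le> (\<epsilon> / 2) * (\<sigma> * X x)"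
        using \<epsilon> by (auto intro: mult_left_mono)
      then show "x \<in> {x \<in> space M. exp (\<epsilon>\<^sup>2 * K / 2) \<le> exp (s * X x)}"
        by (simp add: s_def power2_eq_square ac_simps)
    qed measurable
    also have "\<dots> \<le> expectation (\<lambda>x. exp (s * X x)) / exp (\<epsilon>\<^sup>2 * K / 2)"
      by (rule integral_Markov_inequality_measure[where A = "{}"]) (use mom in auto)
    also have "\<dots> \<le> exp (\<epsilon>\<^sup>2 / 4 * K) / exp (\<epsilon>\<^sup>2 * K / 2)"
    proof (intro divide_right_mono order_trans[OF mom(2)])
      show "exp (s\<^sup>2 * (\<Sum>e\<in>F. prob (S e))) \<le> exp (\<epsilon>\<^sup>2 / 4 * K)"
        unfolding s2 using K by (simp add: mult_left_mono)
    qed simp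
    also have "\<dots> = exp (- \<epsilon>\<^sup>2 * K / 4)"
      by (simp add: exp_diff[symmetric])
    finally show ?thesis .
  qed
  have "{x \<in> space M. \<bar>X x\<bar> \<ge> \<epsilon> * K} =
      {x \<in> space M. 1 * X x \<ge> \<epsilon> * K} \<union> {x \<in> space M. -1 * X x \<ge> \<epsilon> * K}"
    by auto
  then have "prob {x \<in> space M. \<bar>X x\<bar> \<ge> \<epsilon> * K} \<le>
      prob {x \<in> space M. 1 * X x \<ge> \<epsilon> * K} + prob {x \<in> space M. -1 * X x \<ge> \<epsilon> * K}"
    by (simp only:) (intro measure_Un_le; measurable)
  then show ?thesis
    using tail[of 1] tail[of "-1"] by (simp add: X_def)
qed

end

section \<open>Modularity of the random graph\<close>

lemma weighted_graph_unit_weights: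
  assumes "finite V" "E \<subseteq> vertex_pairs V"
  shows "weighted_graph V (unit_weights E)"
proof -
  have "{v} \<notin> E" for v
    using assms(2) by (auto simp: vertex_pairs_def)
  then show ?thesis
    using assms(1) by (auto simp: weighted_graph_def unit_weights_def insert_commute)
qed

text \<open>The exceptional event \<open>B\<close> is a union with one term for each partition, of which there are
  at most \<open>n ^ n\<close>, and one for each vertex. The scale of the deviation is the total weight
  \<open>n * d / 2\<close> for a partition and the degree \<open>d\<close> for a vertex.\<close>

lemma (in prob_space) random_graph_modularity_close:
  fixes V :: "'v set" and E :: "'a \<Rightarrow> 'v set set" and d \<epsilon> :: real
  assumes G: "weighted_graph V w" and reg: "wregular V w d" and d: "d > 0" and ne: "V \<noteq> {}"
    and R: "random_graph M V w E" and \<epsilon>: "0 < \<epsilon>" "\<epsilon> < 1"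
  defines "n \<equiv> card V"
  obtains B where "B \<in> events"
    and "prob B \<le> real n ^ n * (2 * exp (- \<epsilon>\<^sup>2 * (real n * d / 2) / 4))
           + real n * (2 * exp (- \<epsilon>\<^sup>2 * d / 4))"
    and "\<And>x. x \<in> space M - B \<Longrightarrow> \<bar>modularity V w - modularity V (unit_weights (E x))\<bar> \<le> 6 * \<epsilon>"
proof -
  define S where "S e = {x \<in> space M. e \<in> E x}" for e
  define D where "D F K = {x \<in> space M.
    \<bar>(\<Sum>e\<in>F. indicator (S e) x) - (\<Sum>e\<in>F. prob (S e))\<bar> \<ge> \<epsilon> * K}" for F K
  define B where "B = (\<Union>P\<in>{P. partition_on V P}. D (inner_pairs P) (edge_weight w V)) \<union>
    (\<Union>v\<in>V. D (star V v) d)"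
  have fin: "finite V"
    using G by (simp add: weighted_graph_def)
  have E_sub: "E x \<subseteq> vertex_pairs V" if "x \<in> space M" for x
    using R that by (simp add: random_graph_def)
  have "indep_events S (vertex_pairs V)"
    using R by (simp add: random_graph_def S_def[abs_def])
  then have ind: "indep_events S F" if "F \<subseteq> vertex_pairs V" for F
    using that unfolding indep_events_def by (meson image_mono order_trans)
  have finF: "finite F" if "F \<subseteq> vertex_pairs V" for F
    using that finite_vertex_pairs[OF fin] by (rule finite_subset)
  have w_eq: "w u v = prob (S {u, v})" if "u \<in> V" "v \<in> V" "u \<noteq> v" for u v
    using R that by (simp add: random_graph_def S_def)
  have diag: "w v v = 0" if "v \<in> V" for v
    using G that by (simp add: weighted_graph_def)
  have deg: "wdegree V w v = d" if "v \<in> V" for v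
    using reg that by (simp add: wregular_def)
  have total: "edge_weight w V = real n * d / 2"
    using handshake[OF G] deg by (simp add: n_def)
  have inner: "(\<Sum>e\<in>inner_pairs P. prob (S e)) = (\<Sum>A\<in>P. edge_weight w A)" if "partition_on V P" for P
    using inner_weight_eq_sum_pairs[OF fin that, of w "\<lambda>e. prob (S e)"] w_eq by simp
  have star: "(\<Sum>e\<in>star V v. prob (S e)) = d" if "v \<in> V" for v
    using wdegree_eq_sum_star[where w = w and p = "\<lambda>e. prob (S e)", OF fin that diag[OF that]]
      w_eq that deg by simp
  have D_events: "D F K \<in> events" if "F \<subseteq> vertex_pairs V" for F K
  proof -
    have S: "S e \<in> events" if "e \<in> F" for e
      using ind[OF \<open>F \<subseteq> vertex_pairs V\<close>] that by (auto simp: indep_events_def)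
    have [measurable]: "(\<lambda>x. \<Sum>e\<in>F. indicator (S e) x :: real) \<in> borel_measurable M"
      using S by (intro borel_measurable_sum borel_measurable_indicator)
    show ?thesis
      unfolding D_def by measurable
  qed
  have D_prob: "prob (D F K) \<le> 2 * exp (- \<epsilon>\<^sup>2 * K / 4)"
    if "F \<subseteq> vertex_pairs V" "(\<Sum>e\<in>F. prob (S e)) \<le> K" for F K
    unfolding D_def using that \<epsilon>
    by (intro indep_events_concentration finF ind) auto

  have inner_events: "D (inner_pairs P) K \<in> events" if "partition_on V P" for P K
    using that by (intro D_events inner_pairs_subset)
  have star_events: "D (star V v) K \<in> events" if "v \<in> V" for v K
    using that by (intro D_events star_subset)
  have finQ: "finite {P. partition_on V P}"
    using finitely_many_partition_on[OF fin] .
  have "prob (\<Union>P\<in>{P. partition_on V P}. D (inner_pairs P) (edge_weight w V)) \<le>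
      (\<Sum>P\<in>{P. partition_on V P}. prob (D (inner_pairs P) (edge_weight w V)))"
    using inner_events by (intro finite_measure_subadditive_finite finQ) auto
  also have "\<dots> \<le> (\<Sum>P\<in>{P. partition_on V P}. 2 * exp (- \<epsilon>\<^sup>2 * edge_weight w V / 4))"
    using inner_weight_le[OF G] inner by (intro sum_mono D_prob inner_pairs_subset) auto
  also have "\<dots> \<le> real n ^ n * (2 * exp (- \<epsilon>\<^sup>2 * edge_weight w V / 4))"
  proof -
    have "real (card {P. partition_on V P}) \<le> real n ^ n"
      using card_partitions_le[OF fin] unfolding n_def by (metis of_nat_le_iff of_nat_power)
    then show ?thesis
      by (simp add: mult_right_mono)
  qed
  finally have B1: "prob (\<Union>P\<in>{P. partition_on V P}. D (inner_pairs P) (edge_weight w V)) \<le>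
    real n ^ n * (2 * exp (- \<epsilon>\<^sup>2 * (real n * d / 2) / 4))"
    by (simp add: total)
  have "prob (\<Union>v\<in>V. D (star V v) d) \<le> (\<Sum>v\<in>V. prob (D (star V v) d))"
    using star_events by (intro finite_measure_subadditive_finite fin) auto
  also have "\<dots> \<le> (\<Sum>v\<in>V. 2 * exp (- \<epsilon>\<^sup>2 * d / 4))"
    using star by (intro sum_mono D_prob star_subset) auto
  finally have B2: "prob (\<Union>v\<in>V. D (star V v) d) \<le> real n * (2 * exp (- \<epsilon>\<^sup>2 * d / 4))"
    by (simp add: n_def)

  show thesis
  proof (rule that)
    show "B \<in> events"
      unfolding B_def using inner_events star_events finQ fin
      by (intro sets.Un sets.finite_UN) auto
    have "prob B \<le> prob (\<Union>P\<in>{P. partition_on V P}. D (inner_pairs P) (edge_weight w V)) +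
        prob (\<Union>v\<in>V. D (star V v) d)"
      unfolding B_def using inner_events star_events finQ fin
      by (intro measure_Un_le sets.finite_UN) auto
    then show "prob B \<le> real n ^ n * (2 * exp (- \<epsilon>\<^sup>2 * (real n * d / 2) / 4))
        + real n * (2 * exp (- \<epsilon>\<^sup>2 * d / 4))"
      using B1 B2 by linarith
    fix x assume x: "x \<in> space M - B"
    then have xM: "x \<in> space M" by simp
    let ?w' = "unit_weights (E x)"
    have G': "weighted_graph V ?w'"
      using weighted_graph_unit_weights[OF fin E_sub[OF xM]] .
    have w'_eq: "?w' u v = indicator (S {u, v}) x" for u v
      using xM by (simp add: unit_weights_def S_def indicator_def)
    show "\<bar>modularity V w - modularity V ?w'\<bar> \<le> 6 * \<epsilon>"
    proof (intro modularity_stable fin partition_modularity_stable G G')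
      fix P assume P: "partition_on V P"
      then show "partition_on V P" .
      have "x \<notin> D (inner_pairs P) (edge_weight w V)"
        using x P by (auto simp: B_def)
      moreover have "(\<Sum>A\<in>P. edge_weight ?w' A) = (\<Sum>e\<in>inner_pairs P. indicator (S e) x)"
        using w'_eq by (intro inner_weight_eq_sum_pairs[OF fin P])
      ultimately show "\<bar>(\<Sum>A\<in>P. edge_weight ?w' A) - (\<Sum>A\<in>P. edge_weight w A)\<bar> \<le> \<epsilon> * edge_weight w V"
        using xM inner[OF P] by (simp add: D_def)
    next
      fix v assume v: "v \<in> V"
      have "x \<notin> D (star V v) d"
        using x v by (auto simp: B_def)
      moreover have "wdegree V ?w' v = (\<Sum>e\<in>star V v. indicator (S e) x)"
        using w'_eq G' v by (intro wdegree_eq_sum_star fin) (auto simp: weighted_graph_def)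
      ultimately show "\<bar>wdegree V ?w' v - wdegree V w v\<bar> \<le> \<epsilon> * wdegree V w v"
        using xM star[OF v] deg[OF v] by (simp add: D_def)
    next
      show "edge_weight w V > 0"
        using d fin ne by (simp add: total n_def card_gt_0_iff)
    qed (use \<epsilon> in auto)
  qed
qed

text \<open>The constant \<open>3\<close> leaves room for the union bounds: one multiple of \<open>n * ln n\<close> pays for the
  \<open>n ^ n\<close> partitions, and the other two leave the summable \<open>1 / n\<^sup>2\<close>.\<close>

lemma failure_bound:
  fixes d \<epsilon> :: real
  assumes n: "n \<ge> 1" and d: "3 * ln (real n) \<le> \<epsilon>\<^sup>2 / 8 * d"
  shows "real n ^ n * (2 * exp (- \<epsilon>\<^sup>2 * (real n * d / 2) / 4)) + real n * (2 * exp (- \<epsilon>\<^sup>2 * d / 4))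
    \<le> 4 * (1 / real n ^ 2)"
proof -
  define L where "L = ln (real n)"
  have L: "0 \<le> L" "exp L = real n"
    using n by (auto simp: L_def)
  have pow: "real n ^ k = exp (real k * L)" for k
    by (simp add: L(2) exp_of_nat_mult)
  have target: "1 / real n ^ 2 = exp (- 2 * L)"
    by (simp add: pow exp_minus field_simps)
  have "real n * (3 * L) \<le> real n * (\<epsilon>\<^sup>2 / 8 * d)"
    using d by (intro mult_left_mono) (auto simp: L_def)
  moreover have "1 * L \<le> real n * L"
    using n L by (intro mult_right_mono) auto
  ultimately have "real n * L + (- \<epsilon>\<^sup>2 * (real n * d / 2) / 4) \<le> - 2 * L"
    by (simp add: algebra_simps)
  then have first: "exp (real n * L) * exp (- \<epsilon>\<^sup>2 * (real n * d / 2) / 4) \<le> exp (- 2 * L)"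
    unfolding exp_add[symmetric] by simp
  have "3 * L \<le> \<epsilon>\<^sup>2 / 8 * d"
    using d by (simp add: L_def)
  then have "L + (- \<epsilon>\<^sup>2 * d / 4) \<le> - 2 * L"
    using L(1) by simp
  then have second: "exp L * exp (- \<epsilon>\<^sup>2 * d / 4) \<le> exp (- 2 * L)"
    unfolding exp_add[symmetric] by simp
  show ?thesis
    using first second unfolding target by (simp add: pow L(2))
qed

theorem theorem3p1:
  fixes V :: "nat \<Rightarrow> 'a set"
    and w :: "nat \<Rightarrow> 'a \<Rightarrow> 'a \<Rightarrow> real"
    and d l :: "nat \<Rightarrow> real"
    and M :: "'b measure"
    and H' :: "nat \<Rightarrow> 'b \<Rightarrow> 'a set set"
  assumes "\<And>n. n \<ge> 2 \<Longrightarrow> ndl_graph n (d n) (l n) (V n) (w n)"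
    and "\<And>n u v. n \<ge> 2 \<Longrightarrow> u \<in> V n \<Longrightarrow> v \<in> V n \<Longrightarrow> w n u v \<in> {0..1}"
    and "prob_space M"
    and "\<And>n. n \<ge> 2 \<Longrightarrow> random_graph M (V n) (w n) (H' n)"
    and "filterlim (\<lambda>n. d n / real n powr (1/2)) at_top sequentially"
    and "limsup (\<lambda>n. ereal (l n / d n)) < 1"
  shows "AE x in M. (\<lambda>n. \<bar>modularity (V n) (w n) -
           modularity (V n) (unit_weights (H' n x))\<bar>) \<longlonglongrightarrow> 0"
proof -
  interpret prob_space M by fact
  define \<Delta> where "\<Delta> x n = \<bar>modularity (V n) (w n) - modularity (V n) (unit_weights (H' n x))\<bar>" for x n
  have d_ge: "eventually (\<lambda>n. real n powr (1/2) \<le> d n) sequentially"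
    using filterlim_at_top_dense[THEN iffD1, OF assms(5), rule_format, of 1] eventually_gt_at_top[of 0]
    by eventually_elim (simp add: field_simps)

  have close: "AE x in M. eventually (\<lambda>n. \<Delta> x n \<le> 6 * \<epsilon>) sequentially" if \<epsilon>: "0 < \<epsilon>" "\<epsilon> < 1" for \<epsilon>
  proof -
    have "eventually (\<lambda>n. 3 * ln (real n) \<le> \<epsilon>\<^sup>2 / 8 * real n powr (1/2)) sequentially"
      using \<epsilon> by real_asymp
    with d_ge eventually_ge_at_top[of "2 :: nat"]
    have "eventually (\<lambda>n. n \<ge> 2 \<and> d n > 0 \<and> 3 * ln (real n) \<le> \<epsilon>\<^sup>2 / 8 * d n) sequentially"
    proof eventually_elim
      case (elim n)
      have "0 < real n powr (1/2)"
        using elim by simp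
      moreover have "\<epsilon>\<^sup>2 / 8 * real n powr (1/2) \<le> \<epsilon>\<^sup>2 / 8 * d n"
        using elim by (intro mult_left_mono) auto
      ultimately show ?case
        using elim by linarith
    qed
    then obtain N where N: "\<And>n. n \<ge> N \<Longrightarrow> n \<ge> 2 \<and> d n > 0 \<and> 3 * ln (real n) \<le> \<epsilon>\<^sup>2 / 8 * d n"
      by (auto simp: eventually_sequentially)
    have "\<exists>B. B \<in> events \<and> prob B \<le> 4 * (1 / real n ^ 2) \<and> (\<forall>x\<in>space M - B. \<Delta> x n \<le> 6 * \<epsilon>)"
      if nN: "n \<ge> N" for n
    proof -
      have G: "weighted_graph (V n) (w n)" "wregular (V n) (w n) (d n)" "card (V n) = n"
        using assms(1)[of n] N[OF nN] by (auto simp: ndl_graph_def)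
      have "V n \<noteq> {}"
        using G(3) N[OF nN] by auto
      then obtain B where B: "B \<in> events"
        "prob B \<le> real n ^ n * (2 * exp (- \<epsilon>\<^sup>2 * (real n * d n / 2) / 4))
           + real n * (2 * exp (- \<epsilon>\<^sup>2 * d n / 4))"
        "\<And>x. x \<in> space M - B \<Longrightarrow> \<Delta> x n \<le> 6 * \<epsilon>"
        using random_graph_modularity_close[OF G(1,2) _ _ assms(4) \<epsilon>] N[OF nN]
        unfolding G(3) \<Delta>_def by metis
      moreover have "prob B \<le> 4 * (1 / real n ^ 2)"
        using B(2) failure_bound[of n \<epsilon> "d n"] N[OF nN] by linarith
      ultimately show ?thesis by blast
    qed
    then obtain B where B: "\<And>n. n \<ge> N \<Longrightarrow> B n \<in> events"
      "\<And>n. n \<ge> N \<Longrightarrow> prob (B n) \<le> 4 * (1 / real n ^ 2)"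
      "\<And>n x. n \<ge> N \<Longrightarrow> x \<in> space M - B n \<Longrightarrow> \<Delta> x n \<le> 6 * \<epsilon>"
      by metis
    (* No information is available below N, so the exceptional events are set to be empty there. *)
    define B' where "B' n = (if n \<ge> N then B n else {})" for n
    have "AE x in M. eventually (\<lambda>n. x \<in> space M - B' n) sequentially"
    proof (rule borel_cantelli_AE1)
      show "B' n \<in> events" for n
        using B(1) by (simp add: B'_def)
      show "emeasure M (B' n) < \<infinity>" for n
        by (simp add: emeasure_eq_measure)
      show "summable (\<lambda>n. prob (B' n))"
      proof (rule summable_comparison_test'[where N = N])
        show "summable (\<lambda>n. 4 * (1 / real n ^ 2))"
          using inverse_power_summable[of 2, where 'a = real]
          by (intro summable_mult) (simp add: inverse_eq_divide)
        show "norm (prob (B' n)) \<le> 4 * (1 / real n ^ 2)" if "n \<ge> N" for n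
          using B(2)[OF that] that by (simp add: B'_def)
      qed
    qed
    then show ?thesis
    proof eventually_elim
      case (elim x)
      then show ?case
        using eventually_ge_at_top[of N]
        by eventually_elim (use B(3) in \<open>auto simp: B'_def\<close>)
    qed
  qed
  have "AE x in M. \<forall>k. eventually (\<lambda>n. \<Delta> x n \<le> 6 * (1 / real (k + 2))) sequentially"
    unfolding AE_all_countable by (intro allI close) auto
  then have "AE x in M. \<Delta> x \<longlonglongrightarrow> 0"
  proof eventually_elim
    case (elim x)
    show ?case
    proof (rule tendstoI)
      fix r :: real assume "r > 0"
      then have "eventually (\<lambda>k. 6 * (1 / real (k + 2)) < r) sequentially"
        by real_asymp
      then obtain k where k: "6 * (1 / real (k + 2)) < r"
        by (auto simp: eventually_sequentially)
      from elim[rule_format, of k]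
      show "eventually (\<lambda>n. dist (\<Delta> x n) 0 < r) sequentially"
        by eventually_elim (use k in \<open>auto simp: \<Delta>_def\<close>)
    qed
  qed
  then show ?thesis
    by (simp add: \<Delta>_def[abs_def])
qed

end
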